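(* Let $R$ be a Noetherian integral domain that is not a field and $I$ an ideal of $R$. Consider the following statements. (1) $R$ is a Dedekind domain. (2) If $I$ is a weakly $1$-absorbing prime ideal of $R$, then $I=M$ or $I=M^2$, where $M$ is a maximal ideal of $R$. (3) If $I$ is a weakly $1$-absorbing prime ideal of $R$, then $I=P$ or $I=P^2$, where $P=\sqrt{I}$ is a prime ideal of $R$. Then $(1)\Rightarrow(2)\Rightarrow(3)$.
   Context: All rings are commutative with identity. A proper ideal $I$ of a ring $R$ (i.e. $I\neq R$) is called weakly $1$-absorbing prime if for all nonunit elements $a,b,c\in R$ with $0\neq abc\in I$, either $ab\in I$ or $c\in I$. For an integral domain $R$ with quotient field $K$, a proper ideal $I$ of $R$ is called invertible if $II^{-1}=R$, where $I^{-1}=\{r\in K : rI\subseteq R\}$. An integral domain $R$ is called a Dedekind domain if every nonzero proper ideal of $R$ is invertible. $\sqrt{I}$ denotes the radical of $I$.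
   Formalization: In statement (2) the ideal I is additionally required to be nonzero, since the zero ideal of a domain that is not a field (e.g. of the integers) is vacuously weakly 1-absorbing prime but is neither M nor M^2; statements (1) and (3) are unchanged. *)

theory Defs
  imports "HOL-Algebra.Algebra"
begin

text \<open>
  The quotient field of an integral domain, as a ring object over equivalence classes of pairs
  (numerator, denominator).  The operations on classes are unions over representatives; their
  values on fractions are given by \<open>fraction_mult\<close> and \<open>fraction_add\<close> below.
\<close>

definition fraction_rel :: "('a, 'b) ring_scheme \<Rightarrow> (('a \<times> 'a) \<times> ('a \<times> 'a)) set" where
  "fraction_rel R = {((a, b), (c, d)). a \<in> carrier R \<and> c \<in> carrier R \<and>
     b \<in> carrier R - {\<zero>\<^bsub>R\<^esub>} \<and> d \<in> carrier R - {\<zero>\<^bsub>R\<^esub>} \<and> a \<otimes>\<^bsub>R\<^esub> d = c \<otimes>\<^bsub>R\<^esub> b}"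

definition fraction :: "('a, 'b) ring_scheme \<Rightarrow> 'a \<Rightarrow> 'a \<Rightarrow> ('a \<times> 'a) set" where
  "fraction R a b = fraction_rel R `` {(a, b)}"

definition quotient_field :: "('a, 'b) ring_scheme \<Rightarrow> ('a \<times> 'a) set ring" where
  "quotient_field R =
    \<lparr> carrier = (carrier R \<times> (carrier R - {\<zero>\<^bsub>R\<^esub>})) // fraction_rel R,
      monoid.mult = (\<lambda>A B. \<Union>p\<in>A. \<Union>q\<in>B. fraction R (fst p \<otimes>\<^bsub>R\<^esub> fst q) (snd p \<otimes>\<^bsub>R\<^esub> snd q)),
      one = fraction R \<one>\<^bsub>R\<^esub> \<one>\<^bsub>R\<^esub>,
      ring.zero = fraction R \<zero>\<^bsub>R\<^esub> \<one>\<^bsub>R\<^esub>,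
      add = (\<lambda>A B. \<Union>p\<in>A. \<Union>q\<in>B.
               fraction R (fst p \<otimes>\<^bsub>R\<^esub> snd q \<oplus>\<^bsub>R\<^esub> fst q \<otimes>\<^bsub>R\<^esub> snd p) (snd p \<otimes>\<^bsub>R\<^esub> snd q)) \<rparr>"

definition to_quotient_field :: "('a, 'b) ring_scheme \<Rightarrow> 'a \<Rightarrow> ('a \<times> 'a) set" where
  "to_quotient_field R a = fraction R a \<one>\<^bsub>R\<^esub>"

definition ideal_inverse :: "('a, 'b) ring_scheme \<Rightarrow> 'a set \<Rightarrow> ('a \<times> 'a) set set" where
  "ideal_inverse R I = {r \<in> carrier (quotient_field R).
     \<forall>x \<in> I. r \<otimes>\<^bsub>quotient_field R\<^esub> to_quotient_field R x \<in> to_quotient_field R ` carrier R}"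

text \<open>
  The library's \<open>ideal_prod\<close> forms all nonempty finite sums of products of two arbitrary subsets,
  so it applies to fractional ideals inside the quotient field.
\<close>

definition invertible_ideal :: "'a set \<Rightarrow> ('a, 'b) ring_scheme \<Rightarrow> bool" where
  "invertible_ideal I R \<longleftrightarrow> ideal I R \<and> I \<noteq> carrier R \<and>
     ideal_prod (quotient_field R) (to_quotient_field R ` I) (ideal_inverse R I)
       = to_quotient_field R ` carrier R"

definition dedekind_domain :: "('a, 'b) ring_scheme \<Rightarrow> bool" where
  "dedekind_domain R \<longleftrightarrow> domain R \<and>
     (\<forall>I. ideal I R \<and> I \<noteq> {\<zero>\<^bsub>R\<^esub>} \<and> I \<noteq> carrier R \<longrightarrow> invertible_ideal I R)"

definition weakly_1_absorbing_prime :: "'a set \<Rightarrow> ('a, 'b) ring_scheme \<Rightarrow> bool" where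
  "weakly_1_absorbing_prime I R \<longleftrightarrow> ideal I R \<and> I \<noteq> carrier R \<and>
     (\<forall>a \<in> carrier R - Units R. \<forall>b \<in> carrier R - Units R. \<forall>c \<in> carrier R - Units R.
        a \<otimes>\<^bsub>R\<^esub> b \<otimes>\<^bsub>R\<^esub> c \<noteq> \<zero>\<^bsub>R\<^esub> \<and> a \<otimes>\<^bsub>R\<^esub> b \<otimes>\<^bsub>R\<^esub> c \<in> I \<longrightarrow> a \<otimes>\<^bsub>R\<^esub> b \<in> I \<or> c \<in> I)"

definition ideal_radical :: "('a, 'b) ring_scheme \<Rightarrow> 'a set \<Rightarrow> 'a set" where
  "ideal_radical R I = {x \<in> carrier R. \<exists>n::nat. n > 0 \<and> x [^]\<^bsub>R\<^esub> n \<in> I}"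


text \<open>The construction does give a field into which the domain embeds.\<close>

context "domain"
begin

lemma fraction_rel_equiv: "equiv (carrier R \<times> (carrier R - {\<zero>})) (fraction_rel R)"
proof (rule equivI)
  show "fraction_rel R \<subseteq>
      (carrier R \<times> (carrier R - {\<zero>})) \<times> (carrier R \<times> (carrier R - {\<zero>}))"
    by (auto simp: fraction_rel_def)
  show "refl_on (carrier R \<times> (carrier R - {\<zero>})) (fraction_rel R)"
    by (auto simp: refl_on_def fraction_rel_def)
  show "sym (fraction_rel R)"
    by (auto simp: sym_def fraction_rel_def)
  show "trans (fraction_rel R)"
  proof (rule transI)
    fix p q r assume "(p, q) \<in> fraction_rel R" "(q, r) \<in> fraction_rel R"
    then obtain a b c d e f where p: "p = (a, b)" "q = (c, d)" "r = (e, f)"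
      and [simp]: "a \<in> carrier R" "b \<in> carrier R" "c \<in> carrier R" "d \<in> carrier R"
        "e \<in> carrier R" "f \<in> carrier R" "b \<noteq> \<zero>" "d \<noteq> \<zero>" "f \<noteq> \<zero>"
      and eqs: "a \<otimes> d = c \<otimes> b" "c \<otimes> f = e \<otimes> d"
      by (cases p, cases q, cases r) (auto simp: fraction_rel_def)
    have "d \<otimes> (a \<otimes> f) = (a \<otimes> d) \<otimes> f" by (simp add: m_ac)
    also have "\<dots> = (c \<otimes> f) \<otimes> b" by (simp add: eqs(1) m_ac)
    also have "\<dots> = d \<otimes> (e \<otimes> b)" by (simp add: eqs(2) m_ac)
    finally have "a \<otimes> f = e \<otimes> b" by (simp add: m_lcancel)
    then show "(p, r) \<in> fraction_rel R" by (simp add: p fraction_rel_def)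
  qed
qed

lemma fraction_eq_iff:
  assumes "a \<in> carrier R" "b \<in> carrier R - {\<zero>}" "c \<in> carrier R" "d \<in> carrier R - {\<zero>}"
  shows "fraction R a b = fraction R c d \<longleftrightarrow> a \<otimes> d = c \<otimes> b"
  using eq_equiv_class_iff[OF fraction_rel_equiv, of "(a, b)" "(c, d)"] assms
  by (auto simp: fraction_def fraction_rel_def)

lemma fraction_closed:
  assumes "a \<in> carrier R" "b \<in> carrier R - {\<zero>}"
  shows "fraction R a b \<in> carrier (quotient_field R)"
  using assms by (auto simp: quotient_field_def fraction_def intro!: quotientI)

lemma fraction_cases:
  assumes "x \<in> carrier (quotient_field R)"
  obtains a b where "a \<in> carrier R" "b \<in> carrier R - {\<zero>}" "x = fraction R a b"
  using assms by (auto simp: quotient_field_def fraction_def elim!: quotientE)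

lemma fraction_mult:
  assumes "a \<in> carrier R" "b \<in> carrier R - {\<zero>}" "c \<in> carrier R" "d \<in> carrier R - {\<zero>}"
  shows "fraction R a b \<otimes>\<^bsub>quotient_field R\<^esub> fraction R c d = fraction R (a \<otimes> c) (b \<otimes> d)"
proof -
  let ?f = "\<lambda>p q. fraction R (fst p \<otimes> fst q) (snd p \<otimes> snd q)"
  have "congruent2 (fraction_rel R) (fraction_rel R) ?f"
  proof (rule congruent2I')
    fix p p' q q' assume "(p, p') \<in> fraction_rel R" "(q, q') \<in> fraction_rel R"
    then obtain a b a' b' c d c' d'
      where p: "p = (a, b)" "p' = (a', b')" "q = (c, d)" "q' = (c', d')"
      and [simp]: "a \<in> carrier R" "b \<in> carrier R" "a' \<in> carrier R" "b' \<in> carrier R"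
        "c \<in> carrier R" "d \<in> carrier R" "c' \<in> carrier R" "d' \<in> carrier R"
        "b \<noteq> \<zero>" "d \<noteq> \<zero>" "b' \<noteq> \<zero>" "d' \<noteq> \<zero>"
      and eqs: "a \<otimes> b' = a' \<otimes> b" "c \<otimes> d' = c' \<otimes> d"
      by (cases p, cases p', cases q, cases q') (auto simp: fraction_rel_def)
    have "(a \<otimes> c) \<otimes> (b' \<otimes> d') = (a \<otimes> b') \<otimes> (c \<otimes> d')" by (simp add: m_ac)
    also have "\<dots> = (a' \<otimes> c') \<otimes> (b \<otimes> d)" by (simp add: eqs m_ac)
    finally show "?f p q = ?f p' q'"
      by (simp add: p fraction_eq_iff integral_iff)
  qed
  from UN_equiv_class2[OF fraction_rel_equiv fraction_rel_equiv this, of "(a, b)" "(c, d)"] assms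
  show ?thesis by (simp add: quotient_field_def fraction_def)
qed

lemma fraction_add:
  assumes "a \<in> carrier R" "b \<in> carrier R - {\<zero>}" "c \<in> carrier R" "d \<in> carrier R - {\<zero>}"
  shows "fraction R a b \<oplus>\<^bsub>quotient_field R\<^esub> fraction R c d =
    fraction R (a \<otimes> d \<oplus> c \<otimes> b) (b \<otimes> d)"
proof -
  let ?f = "\<lambda>p q. fraction R (fst p \<otimes> snd q \<oplus> fst q \<otimes> snd p) (snd p \<otimes> snd q)"
  have "congruent2 (fraction_rel R) (fraction_rel R) ?f"
  proof (rule congruent2I')
    fix p p' q q' assume "(p, p') \<in> fraction_rel R" "(q, q') \<in> fraction_rel R"
    then obtain a b a' b' c d c' d'
      where p: "p = (a, b)" "p' = (a', b')" "q = (c, d)" "q' = (c', d')"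
      and [simp]: "a \<in> carrier R" "b \<in> carrier R" "a' \<in> carrier R" "b' \<in> carrier R"
        "c \<in> carrier R" "d \<in> carrier R" "c' \<in> carrier R" "d' \<in> carrier R"
        "b \<noteq> \<zero>" "d \<noteq> \<zero>" "b' \<noteq> \<zero>" "d' \<noteq> \<zero>"
      and eqs: "a \<otimes> b' = a' \<otimes> b" "c \<otimes> d' = c' \<otimes> d"
      by (cases p, cases p', cases q, cases q') (auto simp: fraction_rel_def)
    have "(a \<otimes> d \<oplus> c \<otimes> b) \<otimes> (b' \<otimes> d') =
        (a \<otimes> b') \<otimes> (d \<otimes> d') \<oplus> (c \<otimes> d') \<otimes> (b \<otimes> b')"
      by (simp add: l_distr r_distr m_ac)
    also have "\<dots> = (a' \<otimes> d' \<oplus> c' \<otimes> b') \<otimes> (b \<otimes> d)"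
      by (simp add: eqs l_distr r_distr m_ac)
    finally show "?f p q = ?f p' q'"
      by (simp add: p fraction_eq_iff integral_iff)
  qed
  from UN_equiv_class2[OF fraction_rel_equiv fraction_rel_equiv this, of "(a, b)" "(c, d)"] assms
  show ?thesis by (simp add: quotient_field_def fraction_def)
qed

lemma quotient_field_zero: "\<zero>\<^bsub>quotient_field R\<^esub> = fraction R \<zero> \<one>"
  and quotient_field_one: "\<one>\<^bsub>quotient_field R\<^esub> = fraction R \<one> \<one>"
  by (simp_all add: quotient_field_def)

lemma nonzero_mult: "b \<in> carrier R - {\<zero>} \<Longrightarrow> d \<in> carrier R - {\<zero>} \<Longrightarrow> b \<otimes> d \<in> carrier R - {\<zero>}"
  by (auto dest: integral)

lemma quotient_field_is_field: "field (quotient_field R)"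
proof -
  note [simp] = fraction_add fraction_mult fraction_closed quotient_field_zero quotient_field_one
    integral_iff
  let ?K = "quotient_field R"
  interpret K: cring ?K
  proof (rule cringI)
    show "abelian_group ?K"
    proof (rule abelian_groupI)
      fix x y assume "x \<in> carrier ?K" "y \<in> carrier ?K"
      then show "x \<oplus>\<^bsub>?K\<^esub> y \<in> carrier ?K"
        by (elim fraction_cases) simp
    next
      show "\<zero>\<^bsub>?K\<^esub> \<in> carrier ?K" by simp
    next
      fix x y z assume "x \<in> carrier ?K" "y \<in> carrier ?K" "z \<in> carrier ?K"
      then show "x \<oplus>\<^bsub>?K\<^esub> y \<oplus>\<^bsub>?K\<^esub> z = x \<oplus>\<^bsub>?K\<^esub> (y \<oplus>\<^bsub>?K\<^esub> z)"
        by (elim fraction_cases) (simp add: l_distr r_distr m_ac a_ac)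
    next
      fix x y assume "x \<in> carrier ?K" "y \<in> carrier ?K"
      then show "x \<oplus>\<^bsub>?K\<^esub> y = y \<oplus>\<^bsub>?K\<^esub> x"
        by (elim fraction_cases) (simp add: m_ac a_ac)
    next
      fix x assume "x \<in> carrier ?K"
      then show "\<zero>\<^bsub>?K\<^esub> \<oplus>\<^bsub>?K\<^esub> x = x"
        by (elim fraction_cases) simp
    next
      fix x assume "x \<in> carrier ?K"
      then obtain a b where ab: "a \<in> carrier R" "b \<in> carrier R - {\<zero>}" "x = fraction R a b"
        by (rule fraction_cases)
      have "fraction R (\<ominus> a) b \<oplus>\<^bsub>?K\<^esub> x = fraction R (\<ominus> a \<otimes> b \<oplus> a \<otimes> b) (b \<otimes> b)"
        using ab by simp
      also have "\<dots> = \<zero>\<^bsub>?K\<^esub>"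
        using ab by (simp add: fraction_eq_iff l_minus l_neg)
      finally show "\<exists>y\<in>carrier ?K. y \<oplus>\<^bsub>?K\<^esub> x = \<zero>\<^bsub>?K\<^esub>"
        using ab by (intro bexI[of _ "fraction R (\<ominus> a) b"]) auto
    qed
  next
    show "comm_monoid ?K"
    proof (rule comm_monoidI)
      fix x y assume "x \<in> carrier ?K" "y \<in> carrier ?K"
      then show "x \<otimes>\<^bsub>?K\<^esub> y \<in> carrier ?K"
        by (elim fraction_cases) simp
    next
      show "\<one>\<^bsub>?K\<^esub> \<in> carrier ?K" by simp
    next
      fix x y z assume "x \<in> carrier ?K" "y \<in> carrier ?K" "z \<in> carrier ?K"
      then show "x \<otimes>\<^bsub>?K\<^esub> y \<otimes>\<^bsub>?K\<^esub> z = x \<otimes>\<^bsub>?K\<^esub> (y \<otimes>\<^bsub>?K\<^esub> z)"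
        by (elim fraction_cases) (simp add: m_ac)
    next
      fix x assume "x \<in> carrier ?K"
      then show "\<one>\<^bsub>?K\<^esub> \<otimes>\<^bsub>?K\<^esub> x = x"
        by (elim fraction_cases) simp
    next
      fix x y assume "x \<in> carrier ?K" "y \<in> carrier ?K"
      then show "x \<otimes>\<^bsub>?K\<^esub> y = y \<otimes>\<^bsub>?K\<^esub> x"
        by (elim fraction_cases) (simp add: m_ac)
    qed
  next
    fix x y z assume "x \<in> carrier ?K" "y \<in> carrier ?K" "z \<in> carrier ?K"
    then show "(x \<oplus>\<^bsub>?K\<^esub> y) \<otimes>\<^bsub>?K\<^esub> z = x \<otimes>\<^bsub>?K\<^esub> z \<oplus>\<^bsub>?K\<^esub> y \<otimes>\<^bsub>?K\<^esub> z"
      by (elim fraction_cases) (simp add: fraction_eq_iff l_distr r_distr m_ac)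
  qed
  show ?thesis
  proof (rule K.cring_fieldI2)
    show "\<zero>\<^bsub>?K\<^esub> \<noteq> \<one>\<^bsub>?K\<^esub>" by (simp add: fraction_eq_iff)
  next
    fix x assume x: "x \<in> carrier ?K" "x \<noteq> \<zero>\<^bsub>?K\<^esub>"
    then obtain a b where ab: "a \<in> carrier R" "b \<in> carrier R - {\<zero>}" "x = fraction R a b"
      by (blast elim: fraction_cases)
    with x(2) have "a \<noteq> \<zero>" by (auto simp: fraction_eq_iff)
    with ab show "\<exists>y\<in>carrier ?K. x \<otimes>\<^bsub>?K\<^esub> y = \<one>\<^bsub>?K\<^esub>"
      by (intro bexI[of _ "fraction R b a"]) (auto simp: fraction_eq_iff m_ac)
  qed
qed

lemma to_quotient_field_hom: "to_quotient_field R \<in> ring_hom R (quotient_field R)"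
  by (rule ring_hom_memI)
    (simp_all add: to_quotient_field_def fraction_closed fraction_mult fraction_add
      quotient_field_one)

lemma to_quotient_field_inj: "inj_on (to_quotient_field R) (carrier R)"
  by (auto simp: inj_on_def to_quotient_field_def fraction_eq_iff)

end

end

theory Submission
  imports Defs
begin

text \<open>
  Let \<open>I\<close> be a nonzero weakly 1-absorbing prime ideal of a Dedekind domain.  Since invertible ideals
  can be cancelled and divide the ideals they contain, \<open>I\<close> is \<open>M\<close>, or \<open>M \<cdot> N\<close>, or
  \<open>M \<cdot> N \<cdot> J\<close> with \<open>M, N\<close> maximal and \<open>J\<close> proper.  In the last case the absorbing property,
  which passes from elements to ideals, gives \<open>M \<cdot> N \<subseteq> I\<close> or \<open>J \<subseteq> I\<close>, and cancellation
  refutes both.  If \<open>I = M \<cdot> N\<close> with \<open>M \<noteq> N\<close>, then \<open>a \<in> M - N\<close> and \<open>b \<in> N - M\<close> violate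
  the absorbing property through \<open>a \<otimes> a \<otimes> b \<in> I\<close>.
\<close>

section \<open>Ideal products and maximal ideals\<close>

lemma ideal_prod_mono:
  assumes "A \<subseteq> A'" "B \<subseteq> B'"
  shows "ideal_prod R A B \<subseteq> ideal_prod R A' B'"
proof
  fix x assume "x \<in> ideal_prod R A B"
  then show "x \<in> ideal_prod R A' B'"
    using assms by induct (auto intro: ideal_prod.intros)
qed

lemma (in ring) ideal_prod_subsetI:
  assumes "ideal I R" "\<And>a b. a \<in> A \<Longrightarrow> b \<in> B \<Longrightarrow> a \<otimes> b \<in> I"
  shows "A \<cdot> B \<subseteq> I"
proof
  fix x assume "x \<in> A \<cdot> B"
  then show "x \<in> I"
    by induct (auto intro: assms additive_subgroup.a_closed[OF ideal.axioms(1)])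
qed

text \<open>Zorn's lemma on the ideals above \<open>I\<close> that omit \<open>\<one>\<close>.
  Properness is expressed by omitting \<open>\<one>\<close> because that condition passes to unions
  of chains.\<close>

lemma (in ring) proper_ideal_subset_maximalideal:
  assumes "ideal I R" "I \<noteq> carrier R"
  obtains M where "maximalideal M R" "I \<subseteq> M"
proof -
  define \<A> where "\<A> = {J. ideal J R \<and> I \<subseteq> J \<and> \<one> \<notin> J}"
  have "\<exists>M\<in>\<A>. \<forall>J\<in>\<A>. M \<subseteq> J \<longrightarrow> J = M"
  proof (rule subset_Zorn)
    fix C assume C: "subset.chain \<A> C"
    show "\<exists>U\<in>\<A>. \<forall>J\<in>C. J \<subseteq> U"
    proof (cases "C = {}")
      \<comment> \<open>The empty union is not an ideal, so \<open>I\<close> itself bounds the empty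
        chain.\<close>
      case True
      moreover have "I \<in> \<A>"
        using assms ideal.one_imp_carrier by (auto simp: \<A>_def)
      ultimately show ?thesis by blast
    next
      case False
      have "subset.chain {J. ideal J R} C"
        using C by (auto simp: pred_on.chain_def \<A>_def)
      from chain_Union_is_ideal[OF this] False have "ideal (\<Union>C) R" by simp
      moreover have "C \<subseteq> \<A>" using C by (simp add: pred_on.chain_def)
      then have "I \<subseteq> \<Union>C" "\<one> \<notin> \<Union>C"
        using False by (fastforce simp: \<A>_def)+
      ultimately show ?thesis by (auto simp: \<A>_def)
    qed
  qed
  then obtain M where M: "ideal M R" "I \<subseteq> M" "\<one> \<notin> M" "\<And>J. J \<in> \<A> \<Longrightarrow> M \<subseteq> J \<Longrightarrow> J = M"
    by (auto simp: \<A>_def)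
  have "maximalideal M R"
  proof (rule maximalidealI[OF M(1)])
    show "carrier R \<noteq> M" using M(3) by auto
    fix J assume J: "ideal J R" "M \<subseteq> J" "J \<subseteq> carrier R"
    show "J = M \<or> J = carrier R"
    proof (cases "\<one> \<in> J")
      case True
      then show ?thesis using J(1) ideal.one_imp_carrier by blast
    next
      case False
      with J M show ?thesis by (auto simp: \<A>_def)
    qed
  qed
  with M(2) show ?thesis using that by blast
qed

section \<open>Colon ideals and multiplication by a principal ideal\<close>

text \<open>The ideal quotient \<open>(I : A)\<close>. It supplies cofactors inside \<open>R\<close>
  where one would otherwise divide in the quotient field.\<close>

definition ideal_colon :: "('a, 'b) ring_scheme \<Rightarrow> 'a set \<Rightarrow> 'a set \<Rightarrow> 'a set" where
  "ideal_colon R I A = {r \<in> carrier R. \<forall>a\<in>A. r \<otimes>\<^bsub>R\<^esub> a \<in> I}"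

lemma (in cring) ideal_colon_is_ideal:
  assumes "ideal I R" "A \<subseteq> carrier R"
  shows "ideal (ideal_colon R I A) R"
proof -
  interpret I: ideal I R by fact
  show ?thesis
  proof (rule idealI)
    show "ring R" by (rule ring_axioms)
    show "subgroup (ideal_colon R I A) (add_monoid R)"
    proof (rule add.subgroupI)
      show "ideal_colon R I A \<subseteq> carrier R" by (auto simp: ideal_colon_def)
      have "\<zero> \<in> ideal_colon R I A" using assms(2) by (auto simp: ideal_colon_def)
      then show "ideal_colon R I A \<noteq> {}" by blast
      show "\<ominus> r \<in> ideal_colon R I A" if "r \<in> ideal_colon R I A" for r
        using that assms(2) by (auto simp: ideal_colon_def l_minus subset_iff)
      show "r \<oplus> s \<in> ideal_colon R I A" if "r \<in> ideal_colon R I A" "s \<in> ideal_colon R I A" for r s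
        using that assms(2) by (auto simp: ideal_colon_def l_distr subset_iff)
    qed
    fix r x assume r: "r \<in> ideal_colon R I A" and x: "x \<in> carrier R"
    show "x \<otimes> r \<in> ideal_colon R I A"
      using r x assms(2) by (auto simp: ideal_colon_def m_assoc subset_iff I.I_l_closed)
    then show "r \<otimes> x \<in> ideal_colon R I A"
      using r x by (simp add: m_comm ideal_colon_def)
  qed
qed

text \<open>The generator \<open>d\<close> can be pulled out of every finite sum of products, so a
  single multiple of \<open>d\<close> remains. This turns cancellation of \<open>PIdl d\<close> into
  cancellation of an element.\<close>

lemma (in cring) cgenideal_prod:
  assumes "ideal A R" "d \<in> carrier R"
  shows "(PIdl d) \<cdot> A = (\<lambda>a. d \<otimes> a) ` A"
proof
  interpret A: ideal A R by fact
  show "(PIdl d) \<cdot> A \<subseteq> (\<lambda>a. d \<otimes> a) ` A"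
  proof
    fix x assume "x \<in> (PIdl d) \<cdot> A"
    then show "x \<in> (\<lambda>a. d \<otimes> a) ` A"
    proof induct
      case (prod i a)
      then obtain r where r: "r \<in> carrier R" "i = r \<otimes> d" by (auto simp: cgenideal_def)
      then have "i \<otimes> a = d \<otimes> (r \<otimes> a)" using prod assms(2) by (simp add: m_ac A.Icarr)
      then show ?case using prod r A.I_l_closed by blast
    next
      case (sum s t)
      then obtain a b where "a \<in> A" "b \<in> A" "s = d \<otimes> a" "t = d \<otimes> b" by blast
      then have "s \<oplus> t = d \<otimes> (a \<oplus> b)" "a \<oplus> b \<in> A" using assms(2) by (simp_all add: r_distr A.Icarr)
      then show ?case by blast
    qed
  qed
  show "(\<lambda>a. d \<otimes> a) ` A \<subseteq> (PIdl d) \<cdot> A"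
    using cgenideal_self[OF assms(2)] by (auto intro: ideal_prod.prod)
qed

lemma (in domain) cgenideal_prod_cancel:
  assumes "ideal A R" "ideal B R" "d \<in> carrier R" "d \<noteq> \<zero>" "(PIdl d) \<cdot> A \<subseteq> (PIdl d) \<cdot> B"
  shows "A \<subseteq> B"
proof
  fix a assume a: "a \<in> A"
  with assms obtain b where b: "b \<in> B" "d \<otimes> a = d \<otimes> b" by (auto simp: cgenideal_prod)
  then have "a = b" using m_lcancel[OF assms(4,3)] a assms(1,2) by (meson ideal.Icarr)
  with b show "a \<in> B" by simp
qed

text \<open>The cofactor is \<open>(A : d)\<close>: each element of \<open>A\<close> is some
  \<open>r \<otimes> d\<close>, and this very equation puts \<open>r\<close> into the colon
  ideal.\<close>

lemma (in cring) cgenideal_dvd: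
  assumes "ideal A R" "d \<in> carrier R" "A \<subseteq> PIdl d"
  obtains B where "ideal B R" "A = (PIdl d) \<cdot> B"
proof
  show B: "ideal (ideal_colon R A {d}) R" using assms by (intro ideal_colon_is_ideal) auto
  show "A = (PIdl d) \<cdot> (ideal_colon R A {d})"
    unfolding cgenideal_prod[OF B assms(2)]
  proof (intro equalityI subsetI)
    fix a assume a: "a \<in> A"
    with assms(3) obtain r where r: "r \<in> carrier R" "a = r \<otimes> d" by (auto simp: cgenideal_def)
    with a have "r \<in> ideal_colon R A {d}" by (simp add: ideal_colon_def)
    moreover have "a = d \<otimes> r" using r assms(2) by (simp add: m_comm)
    ultimately show "a \<in> (\<lambda>b. d \<otimes> b) ` ideal_colon R A {d}" by blast
  next
    fix a assume "a \<in> (\<lambda>b. d \<otimes> b) ` ideal_colon R A {d}"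
    then show "a \<in> A" using assms(2) by (auto simp: ideal_colon_def m_comm)
  qed
qed

section \<open>Cancellation and division by invertible ideals\<close>

text \<open>
  Multiplying the fractional inverse of \<open>M\<close> by any \<open>d \<in> M\<close> lands in \<open>R\<close>; this removes the
  quotient field from the rest of the argument.
\<close>

lemma (in domain) invertible_ideal_prod_principal:
  assumes "invertible_ideal M R" "M \<noteq> {\<zero>}"
  obtains M' d where "ideal M' R" "d \<in> carrier R" "d \<noteq> \<zero>" "M \<cdot> M' = PIdl d"
proof -
  let ?K = "quotient_field R" and ?f = "to_quotient_field R"
  interpret K: field ?K by (rule quotient_field_is_field)
  interpret f: ring_hom_cring R ?K ?f
    by (unfold_locales) (rule to_quotient_field_hom)
  from assms(1) interpret M: ideal M R by (simp add: invertible_ideal_def)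
  obtain d where d: "d \<in> M" "d \<noteq> \<zero>" using assms(2) M.zero_closed by blast
  \<comment> \<open>This is the counterpart in \<open>R\<close> of \<open>d\<close> times the
    fractional inverse of \<open>M\<close>.\<close>
  define M' where "M' = ideal_colon R (PIdl d) M"
  have dR: "d \<in> carrier R" using d M.Icarr by blast
  have M': "ideal M' R"
    unfolding M'_def using dR M.a_subset by (intro ideal_colon_is_ideal cgenideal_ideal)
  have MM': "ideal (M \<cdot> M') R" by (rule ideal_prod_is_ideal[OF M.ideal_axioms M'])
  have f_eq: "?f a = ?f b \<longleftrightarrow> a = b" if "a \<in> carrier R" "b \<in> carrier R" for a b
    using that to_quotient_field_inj by (auto dest: inj_onD)
  have inverse_closed: "q \<in> carrier ?K" if "q \<in> ideal_inverse R M" for q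
    using that by (simp add: ideal_inverse_def)
  have inverseE: "\<exists>b\<in>carrier R. q \<otimes>\<^bsub>?K\<^esub> ?f x = ?f b" if "q \<in> ideal_inverse R M" "x \<in> M" for q x
    using that by (auto simp: ideal_inverse_def)
  \<comment> \<open>Clearing denominators: multiplication by \<open>d\<close> carries the product of
    \<open>M\<close> and its inverse into \<open>M \<cdot> M'\<close>. Membership in the carrier is
    kept in the induction so that the sum case can distribute.\<close>
  have clear: "x \<in> carrier ?K \<and> (\<exists>y\<in>M \<cdot> M'. ?f d \<otimes>\<^bsub>?K\<^esub> x = ?f y)"
    if "x \<in> ideal_prod ?K (?f ` M) (ideal_inverse R M)" for x
    using that
  proof induct
    case (prod i q)
    then obtain a where a: "a \<in> M" "i = ?f a" by blast
    obtain b where b: "b \<in> carrier R" "q \<otimes>\<^bsub>?K\<^esub> ?f d = ?f b" using inverseE prod(2) d by blast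
    have qK: "q \<in> carrier ?K" using prod(2) by (rule inverse_closed)
    have aR: "a \<in> carrier R" using a M.Icarr by blast
    \<comment> \<open>Here \<open>b\<close> is \<open>q\<close> times \<open>d\<close>, so
      \<open>b \<otimes> z\<close> is \<open>q\<close> times \<open>z\<close>, an element of
      \<open>R\<close>, multiplied by \<open>d\<close>.\<close>
    have "b \<in> M'"
      unfolding M'_def ideal_colon_def
    proof (intro CollectI conjI ballI b(1))
      fix z assume z: "z \<in> M"
      then have zR: "z \<in> carrier R" by (rule M.Icarr)
      obtain c where c: "c \<in> carrier R" "q \<otimes>\<^bsub>?K\<^esub> ?f z = ?f c" using inverseE prod(2) z by blast
      have "?f (b \<otimes> z) = (q \<otimes>\<^bsub>?K\<^esub> ?f z) \<otimes>\<^bsub>?K\<^esub> ?f d"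
        using b zR dR qK by (simp add: K.m_ac flip: b(2))
      also have "\<dots> = ?f (c \<otimes> d)" using c dR by simp
      finally have "b \<otimes> z = c \<otimes> d"
        using b(1) zR c(1) dR by (subst (asm) f_eq) auto
      then show "b \<otimes> z \<in> PIdl d" using c by (auto simp: cgenideal_def)
    qed
    then have "a \<otimes> b \<in> M \<cdot> M'" using a by (auto intro: ideal_prod.prod)
    moreover have "?f d \<otimes>\<^bsub>?K\<^esub> (i \<otimes>\<^bsub>?K\<^esub> q) = ?f (a \<otimes> b)"
      using aR b(1) dR qK by (simp add: a(2) K.m_ac flip: b(2))
    moreover have "i \<otimes>\<^bsub>?K\<^esub> q \<in> carrier ?K" using aR qK by (simp add: a(2))
    ultimately show ?case by blast
  next
    case (sum s t)
    then obtain y z where yz: "y \<in> M \<cdot> M'" "?f d \<otimes>\<^bsub>?K\<^esub> s = ?f y"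
      "z \<in> M \<cdot> M'" "?f d \<otimes>\<^bsub>?K\<^esub> t = ?f z" by blast
    then have "y \<in> carrier R" "z \<in> carrier R" using MM' by (auto intro: ideal.Icarr)
    then have "?f d \<otimes>\<^bsub>?K\<^esub> (s \<oplus>\<^bsub>?K\<^esub> t) = ?f (y \<oplus> z)"
      using yz dR sum by (simp add: K.r_distr)
    moreover have "y \<oplus> z \<in> M \<cdot> M'" using yz by (auto intro: ideal_prod.sum)
    ultimately show ?case using sum by blast
  qed
  \<comment> \<open>Invertibility represents \<open>\<one>\<close> in the fractional product;
    clearing denominators turns this into \<open>d \<in> M \<cdot> M'\<close>.\<close>
  have "?f \<one> \<in> ideal_prod ?K (?f ` M) (ideal_inverse R M)"
    using assms(1) unfolding invertible_ideal_def by blast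
  from clear[OF this] obtain y where y: "y \<in> M \<cdot> M'" "?f d \<otimes>\<^bsub>?K\<^esub> ?f \<one> = ?f y" by blast
  have "y \<in> carrier R" using y MM' by (auto intro: ideal.Icarr)
  with y dR have "d = y" by (simp add: f_eq)
  with y MM' have "PIdl d \<subseteq> M \<cdot> M'" by (simp add: cgenideal_minimal)
  moreover have "M \<cdot> M' \<subseteq> PIdl d"
    using dR M.Icarr by (intro ideal_prod_subsetI cgenideal_ideal) (auto simp: M'_def ideal_colon_def m_comm)
  ultimately show ?thesis using that[OF M' dR d(2)] by blast
qed

text \<open>Multiplying by \<open>M'\<close> replaces \<open>M\<close> by a nonzero principal ideal,
  whose generator cancels in a domain.\<close>

lemma (in domain) invertible_ideal_cancel:
  assumes "invertible_ideal M R" "M \<noteq> {\<zero>}" "ideal A R" "ideal B R" "M \<cdot> A \<subseteq> M \<cdot> B"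
  shows "A \<subseteq> B"
proof -
  obtain M' d where M': "ideal M' R" "d \<in> carrier R" "d \<noteq> \<zero>" "M \<cdot> M' = PIdl d"
    using assms by (elim invertible_ideal_prod_principal)
  have M: "ideal M R" using assms(1) by (simp add: invertible_ideal_def)
  have MM': "M' \<cdot> M = PIdl d" using M' M by (simp add: ideal_prod_commute)
  have "M' \<cdot> (M \<cdot> A) \<subseteq> M' \<cdot> (M \<cdot> B)" using assms(5) by (simp add: ideal_prod_mono)
  then show ?thesis
    using cgenideal_prod_cancel[OF assms(3,4) M'(2,3)] M M' assms
    by (simp add: MM' flip: ideal_prod_assoc)
qed

text \<open>From \<open>I \<cdot> M' \<subseteq> M \<cdot> M' = PIdl d\<close> one gets
  \<open>I \<cdot> M' = (PIdl d) \<cdot> J\<close>. Multiplying by \<open>M\<close> and cancelling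
  \<open>d\<close> leaves \<open>I = M \<cdot> J\<close>.\<close>

lemma (in domain) invertible_ideal_dvd:
  assumes "invertible_ideal M R" "M \<noteq> {\<zero>}" "ideal I R" "I \<subseteq> M"
  obtains J where "ideal J R" "I = M \<cdot> J"
proof -
  obtain M' d where M': "ideal M' R" "d \<in> carrier R" "d \<noteq> \<zero>" "M \<cdot> M' = PIdl d"
    using assms by (elim invertible_ideal_prod_principal)
  have M: "ideal M R" using assms(1) by (simp add: invertible_ideal_def)
  have "I \<cdot> M' \<subseteq> PIdl d" using assms(4) by (simp add: ideal_prod_mono flip: M'(4))
  then obtain J where J: "ideal J R" "I \<cdot> M' = (PIdl d) \<cdot> J"
    using cgenideal_dvd M' assms ideal_prod_is_ideal by metis
  have MJ: "ideal (M \<cdot> J) R" using M J by (simp add: ideal_prod_is_ideal)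
  have dI: "ideal (PIdl d) R" using M' by (simp add: cgenideal_ideal)
  have "(PIdl d) \<cdot> (M \<cdot> J) = M \<cdot> ((PIdl d) \<cdot> J)"
    using M J dI ideal_prod_commute[OF M dI] by (simp flip: ideal_prod_assoc)
  also have "\<dots> = (M \<cdot> M') \<cdot> I"
    using M M'(1) assms(3) by (simp add: ideal_prod_assoc ideal_prod_commute[of I] flip: J(2))
  also have "\<dots> = (PIdl d) \<cdot> I" by (simp only: M'(4))
  finally have "I = M \<cdot> J"
    using cgenideal_prod_cancel[OF _ _ M'(2,3)] MJ assms(3) by (intro equalityI) auto
  with J(1) show ?thesis using that by blast
qed

section \<open>The absorbing property for elements and ideals\<close>

lemma (in cring) proper_ideal_nonunits:
  assumes "ideal A R" "A \<noteq> carrier R"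
  shows "A \<subseteq> carrier R - Units R"
proof
  interpret A: ideal A R by fact
  fix a assume a: "a \<in> A"
  have "a \<notin> Units R"
  proof
    assume "a \<in> Units R"
    then have "\<one> = inv a \<otimes> a" "inv a \<in> carrier R" by simp_all
    with a have "\<one> \<in> A" by (metis A.I_l_closed)
    then show False using A.one_imp_carrier assms(2) by blast
  qed
  with a show "a \<in> carrier R - Units R" by (simp add: A.Icarr)
qed

text \<open>If the triple product vanishes in a domain, then \<open>a \<otimes> b\<close> or
  \<open>c\<close> is zero and hence lies in \<open>I\<close>.\<close>

lemma (in domain) weakly_1_absorbing_primeD:
  assumes "weakly_1_absorbing_prime I R" "a \<in> carrier R - Units R" "b \<in> carrier R - Units R"
    "c \<in> carrier R - Units R" "a \<otimes> b \<otimes> c \<in> I"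
  shows "a \<otimes> b \<in> I \<or> c \<in> I"
proof (cases "a \<otimes> b \<otimes> c = \<zero>")
  case True
  then have "a \<otimes> b = \<zero> \<or> c = \<zero>" using assms(2-4) integral_iff by auto
  moreover have "\<zero> \<in> I"
    using assms(1) by (simp add: weakly_1_absorbing_prime_def additive_subgroup.zero_closed ideal.axioms(1))
  ultimately show ?thesis by auto
qed (use assms in \<open>simp add: weakly_1_absorbing_prime_def\<close>)

text \<open>One fixed \<open>c\<close> in \<open>C\<close> outside \<open>I\<close> forces every
  \<open>a \<otimes> b\<close> into \<open>I\<close>, since elements of proper ideals are
  nonunits.\<close>

lemma (in domain) weakly_1_absorbing_prime_ideals:
  assumes "weakly_1_absorbing_prime I R"
    and "ideal A R" "A \<noteq> carrier R" "ideal B R" "B \<noteq> carrier R" "ideal C R" "C \<noteq> carrier R"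
    and "A \<cdot> B \<cdot> C \<subseteq> I"
  shows "A \<cdot> B \<subseteq> I \<or> C \<subseteq> I"
proof (rule disjCI)
  assume "\<not> C \<subseteq> I"
  then obtain c where c: "c \<in> C" "c \<notin> I" by blast
  have I: "ideal I R" using assms(1) by (simp add: weakly_1_absorbing_prime_def)
  show "A \<cdot> B \<subseteq> I"
  proof (rule ideal_prod_subsetI[OF I])
    fix a b assume ab: "a \<in> A" "b \<in> B"
    then have "a \<otimes> b \<otimes> c \<in> I" using assms(8) c(1) by (blast intro: ideal_prod.prod)
    moreover have "a \<in> carrier R - Units R" "b \<in> carrier R - Units R" "c \<in> carrier R - Units R"
      using ab c(1) proper_ideal_nonunits[OF assms(2,3)] proper_ideal_nonunits[OF assms(4,5)]
        proper_ideal_nonunits[OF assms(6,7)] by auto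
    ultimately show "a \<otimes> b \<in> I"
      using weakly_1_absorbing_primeD[OF assms(1)] c(2) by blast
  qed
qed

lemma (in domain) weakly_1_absorbing_prime_maximal_prod:
  assumes "weakly_1_absorbing_prime (M \<cdot> N) R" "maximalideal M R" "maximalideal N R"
  shows "M = N"
proof (rule ccontr)
  assume "M \<noteq> N"
  interpret M: maximalideal M R by fact
  interpret N: maximalideal N R by fact
  have MN: "M \<cdot> N \<subseteq> M" "M \<cdot> N \<subseteq> N"
    using ideal_prod_inter[OF M.ideal_axioms N.ideal_axioms] by auto
  have "\<not> M \<subseteq> N" "\<not> N \<subseteq> M"
    using \<open>M \<noteq> N\<close> M.I_maximal[OF N.ideal_axioms] N.I_maximal[OF M.ideal_axioms]
      M.I_notcarr N.I_notcarr M.a_subset N.a_subset by auto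
  then obtain a b where ab: "a \<in> M" "a \<notin> N" "b \<in> N" "b \<notin> M" by blast
  have "a \<in> carrier R - Units R" "b \<in> carrier R - Units R"
    using ab proper_ideal_nonunits M.ideal_axioms N.ideal_axioms M.I_notcarr N.I_notcarr by blast+
  moreover have "a \<otimes> a \<otimes> b \<in> M \<cdot> N"
    using ab(1,3) M.Icarr by (intro ideal_prod.prod M.I_l_closed) auto
  \<comment> \<open>The alternative \<open>b \<in> M \<cdot> N\<close> would give
    \<open>b \<in> M\<close>. So \<open>a \<otimes> a\<close> lies in the prime ideal
    \<open>N\<close>, against \<open>a \<notin> N\<close>.\<close>
  ultimately have "a \<otimes> a \<in> M \<cdot> N \<or> b \<in> M \<cdot> N" using weakly_1_absorbing_primeD assms(1) by blast
  moreover have "primeideal N R" using assms(3) by (rule maximalideal_prime)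
  ultimately have "a \<otimes> a \<in> N"
    using ab(4) MN by blast
  then show False
    using primeideal.I_prime[OF \<open>primeideal N R\<close>, of a a] ab(1,2) M.Icarr by blast
qed

section \<open>Factorization in a Dedekind domain\<close>

lemma (in domain) dedekind_weakly_1_absorbing_prime:
  assumes "dedekind_domain R" "weakly_1_absorbing_prime I R" "I \<noteq> {\<zero>}"
  shows "\<exists>M. maximalideal M R \<and> (I = M \<or> I = M \<cdot> M)"
proof -
  have I: "ideal I R" "I \<noteq> carrier R"
    using assms(2) by (simp_all add: weakly_1_absorbing_prime_def)
  have inv: "invertible_ideal A R" if "ideal A R" "A \<noteq> {\<zero>}" "A \<noteq> carrier R" for A
    using assms(1) that by (simp add: dedekind_domain_def)
  \<comment> \<open>A maximal ideal containing \<open>A\<close> divides it. The cofactor is recorded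
    as nonzero so that the step can be repeated on it whenever it is proper.\<close>
  have split: "\<exists>M J. maximalideal M R \<and> M \<noteq> {\<zero>} \<and> ideal J R \<and> J \<noteq> {\<zero>} \<and> A = M \<cdot> J"
    if A: "ideal A R" "A \<noteq> {\<zero>}" "A \<noteq> carrier R" for A
  proof -
    obtain M where M: "maximalideal M R" "A \<subseteq> M"
      using A by (elim proper_ideal_subset_maximalideal)
    interpret M: maximalideal M R by fact
    have M0: "M \<noteq> {\<zero>}"
      using M(2) A additive_subgroup.zero_closed[OF ideal.axioms(1)[OF A(1)]] by auto
    moreover have "invertible_ideal M R"
      using M0 inv[OF M.ideal_axioms] M.I_notcarr by blast
    ultimately obtain J where J: "ideal J R" "A = M \<cdot> J"
      using A(1) M(2) by (elim invertible_ideal_dvd)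
    have "J \<noteq> {\<zero>}" using A J ideal_prod_zero[OF M.ideal_axioms] by auto
    with M M0 J show ?thesis by blast
  qed
  obtain M J where M: "maximalideal M R" "M \<noteq> {\<zero>}" and J: "ideal J R" "J \<noteq> {\<zero>}" "I = M \<cdot> J"
    using split I assms(3) by meson
  interpret M: maximalideal M R by fact
  have Minv: "invertible_ideal M R" using inv M M.ideal_axioms M.I_notcarr by simp
  show ?thesis
  proof (cases "J = carrier R")
    case True
    then have "I = M" using J ideal_prod_one[OF M.ideal_axioms] by simp
    with M show ?thesis by blast
  next
    case False
    then obtain N J' where N: "maximalideal N R" "N \<noteq> {\<zero>}"
      and J': "ideal J' R" "J' \<noteq> {\<zero>}" "J = N \<cdot> J'"
      using split J by meson
    interpret N: maximalideal N R by fact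
    have Ninv: "invertible_ideal N R" using inv N N.ideal_axioms N.I_notcarr by simp
    have MN: "ideal (M \<cdot> N) R" by (rule ideal_prod_is_ideal[OF M.ideal_axioms N.ideal_axioms])
    have I_eq: "I = M \<cdot> N \<cdot> J'"
      using J J' M.ideal_axioms N.ideal_axioms by (simp add: ideal_prod_assoc)
    have "J' = carrier R"
    proof (rule ccontr)
      assume proper: "J' \<noteq> carrier R"
      from weakly_1_absorbing_prime_ideals[OF assms(2) M.ideal_axioms M.I_notcarr[symmetric]
          N.ideal_axioms N.I_notcarr[symmetric] J'(1) proper] I_eq
      consider "M \<cdot> N \<subseteq> I" | "J' \<subseteq> I" by blast
      then show False
      proof cases
        \<comment> \<open>Cancelling first \<open>M\<close> and then \<open>N\<close> from
          \<open>M \<cdot> N \<subseteq> M \<cdot> N \<cdot> J'\<close> makes \<open>J'\<close> the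
          whole ring.\<close>
        case 1
        then have "M \<cdot> N \<subseteq> M \<cdot> (N \<cdot> J')" using J J' by simp
        then have "N \<subseteq> N \<cdot> J'"
          using invertible_ideal_cancel[OF Minv M(2) N.ideal_axioms] J J' by blast
        then have "N \<cdot> carrier R \<subseteq> N \<cdot> J'" by (simp add: ideal_prod_one[OF N.ideal_axioms])
        then have "carrier R \<subseteq> J'" by (rule invertible_ideal_cancel[OF Ninv N(2) oneideal J'(1)])
        with proper show False using ideal.Icarr[OF J'(1)] by blast
      next
        \<comment> \<open>Now \<open>J'\<close>, being nonzero and proper, is itself invertible.
          Cancelling it from \<open>J' \<subseteq> J' \<cdot> (M \<cdot> N)\<close> makes
          \<open>M\<close> the whole ring.\<close>
        case 2
        then have "J' \<cdot> carrier R \<subseteq> J' \<cdot> (M \<cdot> N)"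
          using I_eq J' MN by (simp add: ideal_prod_one ideal_prod_commute)
        then have "carrier R \<subseteq> M \<cdot> N"
          by (rule invertible_ideal_cancel[OF inv[OF J'(1,2) proper] J'(2) oneideal MN])
        also have "\<dots> \<subseteq> M" using ideal_prod_inter[OF M.ideal_axioms N.ideal_axioms] by blast
        finally show False using M.I_notcarr M.a_subset by blast
      qed
    qed
    then have "I = M \<cdot> N" using I_eq ideal_prod_one[OF MN] by simp
    moreover from this have "M = N"
      using weakly_1_absorbing_prime_maximal_prod[of M N] assms(2) M(1) N(1) by simp
    ultimately show ?thesis using M by blast
  qed
qed

section \<open>Radicals of a prime ideal and of its square\<close>

lemma (in cring) primeideal_pow_mem:
  assumes "primeideal P R" "x \<in> carrier R" "x [^] (n::nat) \<in> P"
  shows "x \<in> P"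
proof -
  interpret P: primeideal P R by fact
  show ?thesis
    using assms(3)
  proof (induct n)
    case 0
    then have "\<one> \<in> P" by simp
    then have "P = carrier R" by (rule P.one_imp_carrier)
    then show ?case using P.I_notcarr by simp
  next
    case (Suc n)
    then have "x [^] n \<otimes> x \<in> P" by simp
    then have "x [^] n \<in> P \<or> x \<in> P" using assms(2) by (intro P.I_prime) auto
    with Suc(1) show ?case by blast
  qed
qed

lemma (in cring) ideal_radical_primeideal:
  assumes "primeideal P R"
  shows "ideal_radical R P = P"
proof
  interpret P: primeideal P R by fact
  show "ideal_radical R P \<subseteq> P"
    by (auto simp: ideal_radical_def intro: primeideal_pow_mem[OF assms])
  show "P \<subseteq> ideal_radical R P"
  proof
    fix x assume "x \<in> P"
    then have "x \<in> carrier R" "x [^] (1::nat) \<in> P" by (simp_all add: P.Icarr)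
    then show "x \<in> ideal_radical R P" unfolding ideal_radical_def using zero_less_one by blast
  qed
qed

lemma (in cring) ideal_radical_primeideal_square:
  assumes "primeideal P R"
  shows "ideal_radical R (P \<cdot> P) = P"
proof
  interpret P: primeideal P R by fact
  have "P \<cdot> P \<subseteq> P" using ideal_prod_inter[OF P.ideal_axioms P.ideal_axioms] by simp
  then show "ideal_radical R (P \<cdot> P) \<subseteq> P"
    by (auto simp: ideal_radical_def intro: primeideal_pow_mem[OF assms])
  show "P \<subseteq> ideal_radical R (P \<cdot> P)"
  proof
    fix x assume x: "x \<in> P"
    then have "x \<otimes> x \<in> P \<cdot> P" by (intro ideal_prod.prod)
    with x have "x \<in> carrier R" "x [^] (2::nat) \<in> P \<cdot> P"
      by (simp_all add: P.Icarr numeral_2_eq_2)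
    then show "x \<in> ideal_radical R (P \<cdot> P)" unfolding ideal_radical_def using zero_less_numeral by blast
  qed
qed

text \<open>Statement (2) is about nonzero \<open>I\<close>: in a domain \<open>{\<zero>}\<close> is
  vacuously weakly 1-absorbing prime, yet it is neither \<open>M\<close> nor
  \<open>M \<cdot> M\<close> for a maximal \<open>M\<close> unless the ring is a field.\<close>

theorem theorem2p15:
  fixes R :: "('a, 'b) ring_scheme" (structure) and I :: "'a set"
  assumes "noetherian_domain R" and "\<not> field R" and "ideal I R"
  shows "(dedekind_domain R \<longrightarrow>
            (weakly_1_absorbing_prime I R \<and> I \<noteq> {\<zero>} \<longrightarrow>
              (\<exists>M. maximalideal M R \<and> (I = M \<or> I = M \<cdot> M))))
       \<and> ((weakly_1_absorbing_prime I R \<and> I \<noteq> {\<zero>} \<longrightarrow>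
              (\<exists>M. maximalideal M R \<and> (I = M \<or> I = M \<cdot> M))) \<longrightarrow>
            (weakly_1_absorbing_prime I R \<longrightarrow>
              (\<exists>P. P = ideal_radical R I \<and> primeideal P R \<and> (I = P \<or> I = P \<cdot> P))))"
proof -
  interpret noetherian_domain R by fact
  have "\<exists>P. P = ideal_radical R I \<and> primeideal P R \<and> (I = P \<or> I = P \<cdot> P)"
    if "I \<noteq> {\<zero>} \<Longrightarrow> \<exists>M. maximalideal M R \<and> (I = M \<or> I = M \<cdot> M)"
  proof (cases "I = {\<zero>}")
    \<comment> \<open>The zero ideal satisfies (3) with \<open>P = {\<zero>}\<close>, which is prime
      in a domain and its own radical.\<close>
    case True
    then show ?thesis using ideal_radical_primeideal[OF zeroprimeideal] zeroprimeideal by auto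
  next
    case False
    with that obtain M where M: "maximalideal M R" "I = M \<or> I = M \<cdot> M" by blast
    from M(1) have "primeideal M R" by (rule maximalideal_prime)
    with M(2) show ?thesis
      by (auto simp: ideal_radical_primeideal ideal_radical_primeideal_square)
  qed
  then show ?thesis using dedekind_weakly_1_absorbing_prime by blast
qed

end
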